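(* Let $X,Y$ be sets and let $\|\cdot\|_X$, $\|\cdot\|_Y$ be unconditional seminorms on $\mathbb{C}X$, $\mathbb{C}Y$, respectively. Then the unconditional seminorm $\|\cdot\|_{uc}$ associated to the projective cross-seminorm on $\mathbb{C}X\otimes\mathbb{C}Y\simeq\mathbb{C}(X\times Y)$ is given by $$\|\alpha\|_{uc}=\inf_I\sum_{i\in I}\|\alpha_i'\|_X\,\|\alpha_i''\|_Y,\qquad\alpha\in\mathbb{C}(X\times Y),$$ where the infimum is taken over all finite families $\alpha_i'\in\mathbb{C}X$, $\alpha_i''\in\mathbb{C}Y$, $i\in I$, satisfying $$|\alpha|\le\sum_{i\in I}|\alpha_i'|\otimes|\alpha_i''|.$$ It is the largest unconditional cross-seminorm on $\mathbb{C}X\otimes\mathbb{C}Y\simeq\mathbb{C}(X\times Y)$.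
   Context: For a set $X$, $\mathbb{C}X$ is the complex vector space with basis $(u_x)_{x\in X}$; for $a=\sum a_xu_x$ put $|a|=\sum|a_x|u_x$; elements with $a=|a|$ are called radial, and for radial $a,b$ one writes $a\le b$ if $a_x\le b_x$ for all $x$. A seminorm on $\mathbb{C}X$ is unconditional if $|a|\le|b|$ implies $\|a\|\le\|b\|$. Given any seminorm $\|\cdot\|$ on $\mathbb{C}X$, the associated unconditional seminorm is $\|\alpha\|^+=\inf_{|\alpha|\le|\beta|}\|\,|\beta|\,\|$ (infimum over $\beta\in\mathbb{C}X$); it is the largest unconditional seminorm which is majorized by $\|\cdot\|$ on radial elements. A seminorm on the algebraic tensor product $V\otimes W$ of seminormed spaces is a cross-seminorm if $\|v\otimes w\|=\|v\|_V\cdot\|w\|_W$ for all $v,w$. The projective cross-seminorm is the largest cross-seminorm. *)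

theory Defs
  imports Complex_Main "HOL-Library.Poly_Mapping" "HOL-Library.Complex_Order"
begin

text \<open>The space \<open>\<complex>X\<close> is the set of finitely supported functions with support in the
  (possibly empty) set \<open>X\<close>; the basis vector \<open>u\<^sub>x\<close> is \<open>Poly_Mapping.single x 1\<close>.\<close>

definition free_space :: "'x set \<Rightarrow> ('x \<Rightarrow>\<^sub>0 complex) set" where
  "free_space X = {a. Poly_Mapping.keys a \<subseteq> X}"

definition scale :: "complex \<Rightarrow> ('x \<Rightarrow>\<^sub>0 complex) \<Rightarrow> ('x \<Rightarrow>\<^sub>0 complex)" where
  "scale c a = Poly_Mapping.map (\<lambda>z. c * z) a"

definition modulus :: "('x \<Rightarrow>\<^sub>0 complex) \<Rightarrow> ('x \<Rightarrow>\<^sub>0 complex)" where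
  "modulus a = Poly_Mapping.map (\<lambda>z. complex_of_real (cmod z)) a"

text \<open>The coefficientwise order, only used between radial elements.  The relation \<open>\<le>\<close> on
  \<^typ>\<open>complex\<close> (equal imaginary parts, ordered real parts) extends that of the real numbers.\<close>

definition radial_le :: "('x \<Rightarrow>\<^sub>0 complex) \<Rightarrow> ('x \<Rightarrow>\<^sub>0 complex) \<Rightarrow> bool" where
  "radial_le a b \<longleftrightarrow> (\<forall>x. Poly_Mapping.lookup a x \<le> Poly_Mapping.lookup b x)"

text \<open>A seminorm on \<open>\<complex>X\<close> is represented by a function on the whole type; its values
  outside \<open>\<complex>X\<close> are irrelevant.\<close>

definition seminorm_on :: "'x set \<Rightarrow> (('x \<Rightarrow>\<^sub>0 complex) \<Rightarrow> real) \<Rightarrow> bool" where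
  "seminorm_on X N \<longleftrightarrow>
     (\<forall>a\<in>free_space X. 0 \<le> N a) \<and>
     (\<forall>c. \<forall>a\<in>free_space X. N (scale c a) = cmod c * N a) \<and>
     (\<forall>a\<in>free_space X. \<forall>b\<in>free_space X. N (a + b) \<le> N a + N b)"

definition unconditional_on :: "'x set \<Rightarrow> (('x \<Rightarrow>\<^sub>0 complex) \<Rightarrow> real) \<Rightarrow> bool" where
  "unconditional_on X N \<longleftrightarrow>
     (\<forall>a\<in>free_space X. \<forall>b\<in>free_space X. radial_le (modulus a) (modulus b) \<longrightarrow> N a \<le> N b)"

definition unconditional_seminorm_on :: "'x set \<Rightarrow> (('x \<Rightarrow>\<^sub>0 complex) \<Rightarrow> real) \<Rightarrow> bool" where
  "unconditional_seminorm_on X N \<longleftrightarrow> seminorm_on X N \<and> unconditional_on X N"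

definition assoc_unconditional ::
    "'x set \<Rightarrow> (('x \<Rightarrow>\<^sub>0 complex) \<Rightarrow> real) \<Rightarrow> ('x \<Rightarrow>\<^sub>0 complex) \<Rightarrow> real" where
  "assoc_unconditional X N \<alpha> =
     Inf {N (modulus \<beta>) | \<beta>. \<beta> \<in> free_space X \<and> radial_le (modulus \<alpha>) (modulus \<beta>)}"

text \<open>The elementary tensor \<open>a \<otimes> b\<close> under the identification of \<open>\<complex>X \<otimes> \<complex>Y\<close> with
  \<open>\<complex>(X \<times> Y)\<close> that sends \<open>u\<^sub>x \<otimes> u\<^sub>y\<close> to the basis vector at \<open>(x, y)\<close>.\<close>

lift_definition tensor ::
    "('x \<Rightarrow>\<^sub>0 complex) \<Rightarrow> ('y \<Rightarrow>\<^sub>0 complex) \<Rightarrow> ('x \<times> 'y \<Rightarrow>\<^sub>0 complex)"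
  is "\<lambda>a b (x, y). a x * b y"
proof -
  fix a :: "'x \<Rightarrow> complex" and b :: "'y \<Rightarrow> complex"
  assume "finite {x. a x \<noteq> 0}" and "finite {y. b y \<noteq> 0}"
  then have "finite ({x. a x \<noteq> 0} \<times> {y. b y \<noteq> 0})"
    by simp
  then show "finite {p. (case p of (x, y) \<Rightarrow> a x * b y) \<noteq> 0}"
    by (rule rev_finite_subset) auto
qed

lemma tensor_single_single:
  "tensor (Poly_Mapping.single x c) (Poly_Mapping.single y d) = Poly_Mapping.single (x, y) (c * d)"
  by (rule poly_mapping_eqI) (auto simp: tensor.rep_eq lookup_single when_def split: if_splits)

definition cross_seminorm_on ::
    "'x set \<Rightarrow> (('x \<Rightarrow>\<^sub>0 complex) \<Rightarrow> real) \<Rightarrow> 'y set \<Rightarrow> (('y \<Rightarrow>\<^sub>0 complex) \<Rightarrow> real) \<Rightarrow>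
     (('x \<times> 'y \<Rightarrow>\<^sub>0 complex) \<Rightarrow> real) \<Rightarrow> bool" where
  "cross_seminorm_on X NX Y NY N \<longleftrightarrow>
     seminorm_on (X \<times> Y) N \<and>
     (\<forall>v\<in>free_space X. \<forall>w\<in>free_space Y. N (tensor v w) = NX v * NY w)"

definition is_largest_on ::
    "'x set \<Rightarrow> ((('x \<Rightarrow>\<^sub>0 complex) \<Rightarrow> real) \<Rightarrow> bool) \<Rightarrow> (('x \<Rightarrow>\<^sub>0 complex) \<Rightarrow> real) \<Rightarrow> bool" where
  "is_largest_on X P N \<longleftrightarrow> P N \<and> (\<forall>M. P M \<longrightarrow> (\<forall>a\<in>free_space X. M a \<le> N a))"

text \<open>The largest cross-seminorm is uniquely determined on \<open>\<complex>(X \<times> Y)\<close>; the choice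
  only affects the irrelevant values outside that space.\<close>

definition projective ::
    "'x set \<Rightarrow> (('x \<Rightarrow>\<^sub>0 complex) \<Rightarrow> real) \<Rightarrow> 'y set \<Rightarrow> (('y \<Rightarrow>\<^sub>0 complex) \<Rightarrow> real) \<Rightarrow>
     ('x \<times> 'y \<Rightarrow>\<^sub>0 complex) \<Rightarrow> real" where
  "projective X NX Y NY = (SOME N. is_largest_on (X \<times> Y) (cross_seminorm_on X NX Y NY) N)"

end

theory Submission
  imports Defs
begin

text \<open>Write \<open>U \<alpha>\<close> for the infimum of the costs \<open>\<Sum>\<parallel>a\<^sub>i\<parallel> \<parallel>b\<^sub>i\<parallel>\<close> over all majorants
  \<open>\<Sum>|a\<^sub>i| \<otimes> |b\<^sub>i|\<close> of \<open>|\<alpha>|\<close>. Everything follows once \<open>U\<close> is known to be an unconditional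
  cross-seminorm. Indeed, each seminorm that has the cross property is at most the cost on a majorant
  \<open>\<Sum>|a\<^sub>i| \<otimes> |b\<^sub>i|\<close>, by the triangle inequality. Hence \<open>U\<close> dominates all unconditional
  cross-seminorms, and also the unconditional seminorm associated to the projective one, for
  which the majorant is an admissible radial competitor. Conversely, the projective
  seminorm dominates every cross-seminorm, in particular \<open>U\<close>; on a radial vector \<open>|\<beta>| \<ge> |\<alpha>|\<close>
  it is therefore at least \<open>U \<beta> \<ge> U \<alpha>\<close>.

  That \<open>U\<close> is an unconditional seminorm with \<open>U (v \<otimes> w) \<le> \<parallel>v\<parallel> \<parallel>w\<parallel>\<close> is immediate. The opposite
  inequality is the only analytic point (\<open>elementary_tensor_cost_ge\<close>). By a finite-dimensional
  Hahn-Banach theorem (\<open>finite_hahn_banach\<close>), an unconditional seminorm is attained at \<open>v\<close> by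
  \<open>a \<mapsto> \<Sum>g x |a x|\<close> for nonnegative weights \<open>g\<close> with which this sum never exceeds the seminorm
  (\<open>norming_weights\<close>). Summing \<open>|v| \<otimes> |w| \<le> \<Sum>|a\<^sub>i| \<otimes> |b\<^sub>i|\<close> against the product of such weights
  for \<open>v\<close> and \<open>w\<close> gives \<open>\<parallel>v\<parallel> \<parallel>w\<parallel> \<le> \<Sum>\<parallel>a\<^sub>i\<parallel> \<parallel>b\<^sub>i\<parallel>\<close>.

  The projective cross-seminorm is specified only as the largest cross-seminorm, so its existence is
  part of the claim: it is the pointwise supremum of all cross-seminorms, and the family is
  nonempty because \<open>U\<close> belongs to it (\<open>largest_cross_seminorm_exists\<close>).\<close>

section \<open>Dominated functionals on finitely many coordinates\<close>

definition sublinear :: "(('x \<Rightarrow> real) \<Rightarrow> real) \<Rightarrow> bool" where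
  "sublinear p \<longleftrightarrow>
     (\<forall>u w. p (\<lambda>x. u x + w x) \<le> p u + p w) \<and> (\<forall>t\<ge>0. \<forall>u. p (\<lambda>x. t * u x) = t * p u)"

lemma sublinear_add: "sublinear p \<Longrightarrow> p (\<lambda>x. u x + w x) \<le> p u + p w"
  unfolding sublinear_def by blast

lemma sublinear_scale: "sublinear p \<Longrightarrow> 0 \<le> t \<Longrightarrow> p (\<lambda>x. t * u x) = t * p u"
  unfolding sublinear_def by blast

lemma sublinear_zero: "sublinear p \<Longrightarrow> p (\<lambda>x. 0) = 0"
  using sublinear_scale[of p 0 "\<lambda>x. 0"] by simp

lemma sublinear_uminus: "sublinear p \<Longrightarrow> - p (\<lambda>x. - u x) \<le> p u"
  using sublinear_add[of p u "\<lambda>x. - u x"] sublinear_zero[of p] by simp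

lemma sublinear_sum:
  assumes "sublinear p" and "finite S"
  shows "p (\<lambda>x. \<Sum>i\<in>S. u i x) \<le> (\<Sum>i\<in>S. p (u i))"
  using \<open>finite S\<close>
proof induction
  case empty
  then show ?case using sublinear_zero[OF \<open>sublinear p\<close>] by simp
next
  case (insert j S)
  then show ?case
    using sublinear_add[OF \<open>sublinear p\<close>, of "u j" "\<lambda>x. \<Sum>i\<in>S. u i x"] by simp
qed

text \<open>The half of homogeneity that an infimum construction gives directly implies the other half,
  because a positive scalar can be inverted.\<close>

lemma sublinearI:
  assumes add: "\<And>u w. p (\<lambda>x. u x + w x) \<le> p u + p w"
    and scale: "\<And>t u. 0 \<le> t \<Longrightarrow> p (\<lambda>x. t * u x) \<le> t * p u"
  shows "sublinear p"
proof -
  have "t * p u \<le> p (\<lambda>x. t * u x)" if "0 \<le> t" for t u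
  proof (cases "t = 0")
    case True
    then show ?thesis using add[of "\<lambda>x. 0" "\<lambda>x. 0"] by simp
  next
    case False
    with that have "p u \<le> inverse t * p (\<lambda>x. t * u x)"
      using scale[of "inverse t" "\<lambda>x. t * u x"] by (simp add: mult.assoc[symmetric])
    with False that show ?thesis by (simp add: field_simps)
  qed
  then show ?thesis
    unfolding sublinear_def using add scale by (blast intro: order_antisym)
qed

text \<open>The functional \<open>u \<mapsto> inf\<^sub>t (p (u + t v) - t p v)\<close>, with \<open>t\<close> ranging over the nonnegative
  reals, is the largest one below \<open>p\<close> that is linear along \<open>v\<close> and keeps the value at \<open>v\<close>:
  \<open>t = 1\<close> at \<open>u = - v\<close> gives the inequality on \<open>- v\<close>. This replaces the extension step of the
  usual proof of the Hahn-Banach theorem, and needs no subspaces.\<close>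

lemma sublinear_flatten:
  assumes p: "sublinear p"
  obtains q where "sublinear q" and "\<And>u. q u \<le> p u" and "q (\<lambda>x. - v x) \<le> - p v"
proof
  define h where "h u t = p (\<lambda>x. u x + t * v x) - t * p v" for u t
  define q where "q u = (INF t\<in>{0..}. h u t)" for u
  have lower: "- p (\<lambda>x. - u x) \<le> h u t" if "0 \<le> t" for u t
    using sublinear_add[OF p, of "\<lambda>x. u x + t * v x" "\<lambda>x. - u x"]
      sublinear_scale[OF p that, of v]
    by (simp add: h_def)
  have bdd: "bdd_below (h u ` {0..})" for u
    by (rule bdd_belowI2[where m = "- p (\<lambda>x. - u x)"]) (simp add: lower)
  have q_le: "q u \<le> h u t" if "0 \<le> t" for u t
    unfolding q_def by (rule cINF_lower[OF bdd]) (use that in simp)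
  have le_q: "c \<le> q u" if "\<And>t. 0 \<le> t \<Longrightarrow> c \<le> h u t" for c u
    unfolding q_def by (rule cINF_greatest) (use that in auto)
  show "sublinear q"
  proof (rule sublinearI)
    fix u w
    have split: "q (\<lambda>x. u x + w x) \<le> h u t + h w s" if "0 \<le> t" "0 \<le> s" for t s
    proof -
      have "(\<lambda>x. u x + w x + (t + s) * v x) = (\<lambda>x. (u x + t * v x) + (w x + s * v x))"
        by (simp add: algebra_simps)
      then have "h (\<lambda>x. u x + w x) (t + s) \<le> h u t + h w s"
        using sublinear_add[OF p, of "\<lambda>x. u x + t * v x" "\<lambda>x. w x + s * v x"]
        by (simp add: h_def algebra_simps)
      with q_le[of "t + s" "\<lambda>x. u x + w x"] that show ?thesis by simp
    qed
    have "q (\<lambda>x. u x + w x) - h w s \<le> q u" if "0 \<le> s" for s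
      using split[OF _ that] by (intro le_q) (simp add: algebra_simps)
    then have "q (\<lambda>x. u x + w x) - q u \<le> q w"
      by (intro le_q) (simp add: algebra_simps)
    then show "q (\<lambda>x. u x + w x) \<le> q u + q w" by simp
  next
    fix c :: real and u
    assume c: "0 \<le> c"
    have scaled: "q (\<lambda>x. c * u x) \<le> c * h u t" if "0 \<le> t" for t
    proof -
      have "h (\<lambda>x. c * u x) (c * t) = c * h u t"
        using sublinear_scale[OF p c, of "\<lambda>x. u x + t * v x"]
        by (simp add: h_def algebra_simps)
      with q_le[of "c * t" "\<lambda>x. c * u x"] that c show ?thesis by simp
    qed
    show "q (\<lambda>x. c * u x) \<le> c * q u"
    proof (cases "c = 0")
      case True
      then show ?thesis using scaled[of 0] by simp
    next
      case False
      have "q (\<lambda>x. c * u x) / c \<le> q u"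
        using scaled c False by (intro le_q) (simp add: field_simps)
      then show ?thesis using c False by (simp add: field_simps)
    qed
  qed
  show "q u \<le> p u" for u
    using q_le[of 0 u] by (simp add: h_def)
  show "q (\<lambda>x. - v x) \<le> - p v"
    using q_le[of 1 "\<lambda>x. - v x"] sublinear_zero[OF p] by (simp add: h_def)
qed

text \<open>Linearity along a vector is inherited by every smaller sublinear functional, so that
  flattening one vector after the other loses nothing.\<close>

lemma sublinear_flatten_finite:
  assumes "finite F" and p: "sublinear p"
  shows "\<exists>q. sublinear q \<and> (\<forall>u. q u \<le> p u) \<and> (\<forall>v\<in>F. q (\<lambda>x. - v x) \<le> - q v)"
  using \<open>finite F\<close>
proof induction
  case empty
  then show ?case using p by auto
next
  case (insert v F)
  then obtain q where q: "sublinear q" "\<And>u. q u \<le> p u" "\<And>w. w \<in> F \<Longrightarrow> q (\<lambda>x. - w x) \<le> - q w"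
    by blast
  obtain r where r: "sublinear r" "\<And>u. r u \<le> q u" "r (\<lambda>x. - v x) \<le> - q v"
    using sublinear_flatten[OF q(1)] by blast
  have "r (\<lambda>x. - w x) \<le> - r w" if "w \<in> insert v F" for w
  proof (cases "w = v")
    case True
    then show ?thesis using r(2)[of v] r(3) by simp
  next
    case False
    with that have "q (\<lambda>x. - w x) \<le> - q w" using q(3) by simp
    then show ?thesis using r(2)[of w] r(2)[of "\<lambda>x. - w x"] by linarith
  qed
  then show ?case using r(1,2) q(2) order_trans by blast
qed

text \<open>The Hahn-Banach theorem on \<open>\<real>\<^sup>S\<close>: flattening \<open>v\<close> first fixes the value at \<open>v\<close>, and
  flattening the coordinate vectors afterwards leaves a linear functional.\<close>

lemma finite_hahn_banach:
  fixes p :: "('x \<Rightarrow> real) \<Rightarrow> real"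
  assumes p: "sublinear p" and S: "finite S" and v: "\<And>x. x \<notin> S \<Longrightarrow> v x = 0"
  obtains f where "\<And>u. (\<And>x. x \<notin> S \<Longrightarrow> u x = 0) \<Longrightarrow> (\<Sum>x\<in>S. f x * u x) \<le> p u"
    and "(\<Sum>x\<in>S. f x * v x) = p v"
proof -
  define e where "e x = (\<lambda>z::'x. if z = x then 1 else 0 :: real)" for x
  obtain p' where p': "sublinear p'" "\<And>u. p' u \<le> p u" "p' (\<lambda>x. - v x) \<le> - p v"
    using sublinear_flatten[OF p] by blast
  from sublinear_flatten_finite[OF _ p'(1), of "e ` S"] S
  obtain q where q: "sublinear q" "\<And>u. q u \<le> p' u" "\<And>x. x \<in> S \<Longrightarrow> q (\<lambda>z. - e x z) \<le> - q (e x)"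
    by auto
  define f where "f x = q (e x)" for x
  have axis: "q (\<lambda>z. c * e x z) \<le> f x * c" if "x \<in> S" for x c
  proof (cases "0 \<le> c")
    case True
    then show ?thesis using sublinear_scale[OF q(1) True] by (simp add: f_def)
  next
    case False
    then have "q (\<lambda>z. c * e x z) = (- c) * q (\<lambda>z. - e x z)"
      using sublinear_scale[OF q(1), of "- c" "\<lambda>z. - e x z"] by simp
    also have "\<dots> \<le> (- c) * (- f x)"
      unfolding f_def using False q(3)[OF that] by (intro mult_left_mono) auto
    finally show ?thesis by (simp add: mult.commute)
  qed
  have upper: "q u \<le> (\<Sum>x\<in>S. f x * u x)" if "\<And>x. x \<notin> S \<Longrightarrow> u x = 0" for u
  proof -
    have "u = (\<lambda>z. \<Sum>x\<in>S. u x * e x z)"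
    proof
      fix z
      have "(\<Sum>x\<in>S. u x * e x z) = (\<Sum>x\<in>S. if z = x then u x else 0)"
        by (rule sum.cong) (auto simp: e_def)
      then show "u z = (\<Sum>x\<in>S. u x * e x z)" using that S by simp
    qed
    then have "q u \<le> (\<Sum>x\<in>S. q (\<lambda>z. u x * e x z))"
      using sublinear_sum[OF q(1) S, of "\<lambda>x z. u x * e x z"] by simp
    also have "\<dots> \<le> (\<Sum>x\<in>S. f x * u x)"
      by (intro sum_mono axis)
    finally show ?thesis .
  qed
  have below: "(\<Sum>x\<in>S. f x * u x) \<le> p u" if "\<And>x. x \<notin> S \<Longrightarrow> u x = 0" for u
  proof -
    have "(\<Sum>x\<in>S. f x * u x) \<le> - q (\<lambda>x. - u x)"
      using upper[of "\<lambda>x. - u x"] that by (simp add: sum_negf)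
    also have "\<dots> \<le> q u" by (rule sublinear_uminus[OF q(1)])
    also have "\<dots> \<le> p u" using q(2) p'(2) order_trans by blast
    finally show ?thesis .
  qed
  moreover have "p v \<le> (\<Sum>x\<in>S. f x * v x)"
    using upper[of v] v sublinear_uminus[OF q(1), of v] q(2)[of "\<lambda>x. - v x"] p'(3) by force
  ultimately show ?thesis using that[of f] v order_antisym by blast
qed

section \<open>Coefficients, seminorms and norming weights\<close>

lemma lookup_scale [simp]: "Poly_Mapping.lookup (scale c a) x = c * Poly_Mapping.lookup a x"
  by (simp add: scale_def map.rep_eq when_def)

lemma lookup_modulus [simp]:
  "Poly_Mapping.lookup (modulus a) x = complex_of_real (cmod (Poly_Mapping.lookup a x))"
  by (simp add: modulus_def map.rep_eq when_def)

lemma lookup_tensor [simp]: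
  "Poly_Mapping.lookup (tensor a b) (x, y) = Poly_Mapping.lookup a x * Poly_Mapping.lookup b y"
  by (simp add: tensor.rep_eq)

lemma free_space_iff: "a \<in> free_space X \<longleftrightarrow> (\<forall>x. x \<notin> X \<longrightarrow> Poly_Mapping.lookup a x = 0)"
  by (auto simp: free_space_def in_keys_iff)

lemma zero_free_space: "0 \<in> free_space X"
  by (simp add: free_space_iff)

lemma add_free_space: "a \<in> free_space X \<Longrightarrow> b \<in> free_space X \<Longrightarrow> a + b \<in> free_space X"
  by (simp add: free_space_iff lookup_add)

lemma scale_free_space: "a \<in> free_space X \<Longrightarrow> scale c a \<in> free_space X"
  by (simp add: free_space_iff)

lemma modulus_free_space: "a \<in> free_space X \<Longrightarrow> modulus a \<in> free_space X"
  by (simp add: free_space_iff)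

lemma sum_free_space: "(\<And>i. i \<in> I \<Longrightarrow> a i \<in> free_space X) \<Longrightarrow> (\<Sum>i\<in>I. a i) \<in> free_space X"
  by (simp add: free_space_iff lookup_sum)

lemma single_free_space: "x \<in> X \<Longrightarrow> Poly_Mapping.single x c \<in> free_space X"
  by (auto simp: free_space_iff lookup_single when_def)

lemma tensor_free_space:
  "a \<in> free_space X \<Longrightarrow> b \<in> free_space Y \<Longrightarrow> tensor a b \<in> free_space (X \<times> Y)"
  by (auto simp: free_space_iff)

lemma radial_le_modulus_iff:
  "radial_le (modulus a) (modulus b) \<longleftrightarrow>
     (\<forall>x. cmod (Poly_Mapping.lookup a x) \<le> cmod (Poly_Mapping.lookup b x))"
  by (simp add: radial_le_def less_eq_complex_def)

lemma radial_le_sum_tensor_iff: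
  "radial_le (modulus \<alpha>) (\<Sum>i\<in>I. tensor (modulus (a i)) (modulus (b i))) \<longleftrightarrow>
     (\<forall>x y. cmod (Poly_Mapping.lookup \<alpha> (x, y)) \<le>
        (\<Sum>i\<in>I. cmod (Poly_Mapping.lookup (a i) x) * cmod (Poly_Mapping.lookup (b i) y)))"
  by (simp add: radial_le_def less_eq_complex_def lookup_sum)

lemma modulus_sum_tensor_modulus:
  "modulus (\<Sum>i\<in>I. tensor (modulus (a i)) (modulus (b i))) =
     (\<Sum>i\<in>I. tensor (modulus (a i)) (modulus (b i)))"
proof (rule poly_mapping_eqI, clarify)
  fix x y
  have "(\<Sum>i\<in>I. Poly_Mapping.lookup (tensor (modulus (a i)) (modulus (b i))) (x, y)) =
      complex_of_real
        (\<Sum>i\<in>I. cmod (Poly_Mapping.lookup (a i) x) * cmod (Poly_Mapping.lookup (b i) y))"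
    by simp
  moreover have "0 \<le>
      (\<Sum>i\<in>I. cmod (Poly_Mapping.lookup (a i) x) * cmod (Poly_Mapping.lookup (b i) y))"
    by (intro sum_nonneg) simp
  ultimately show "Poly_Mapping.lookup (modulus (\<Sum>i\<in>I. tensor (modulus (a i)) (modulus (b i)))) (x, y) =
      Poly_Mapping.lookup (\<Sum>i\<in>I. tensor (modulus (a i)) (modulus (b i))) (x, y)"
    by (simp only: lookup_modulus lookup_sum norm_of_real abs_of_nonneg)
qed

lemma seminorm_nonneg: "seminorm_on X N \<Longrightarrow> a \<in> free_space X \<Longrightarrow> 0 \<le> N a"
  by (simp add: seminorm_on_def)

lemma seminorm_scale: "seminorm_on X N \<Longrightarrow> a \<in> free_space X \<Longrightarrow> N (scale c a) = cmod c * N a"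
  by (simp add: seminorm_on_def)

lemma seminorm_add:
  "seminorm_on X N \<Longrightarrow> a \<in> free_space X \<Longrightarrow> b \<in> free_space X \<Longrightarrow> N (a + b) \<le> N a + N b"
  by (simp add: seminorm_on_def)

lemma seminorm_zero:
  assumes "seminorm_on X N"
  shows "N 0 = 0"
proof -
  have "scale 0 0 = (0 :: 'a \<Rightarrow>\<^sub>0 complex)"
    by (rule poly_mapping_eqI) simp
  then show ?thesis
    using seminorm_scale[OF assms zero_free_space, of 0] by simp
qed

lemma seminorm_sum:
  assumes "seminorm_on X N" and "finite I" and "\<And>i. i \<in> I \<Longrightarrow> a i \<in> free_space X"
  shows "N (\<Sum>i\<in>I. a i) \<le> (\<Sum>i\<in>I. N (a i))"
  using assms(2,3)
proof induction
  case empty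
  then show ?case using seminorm_zero[OF assms(1)] by simp
next
  case (insert j I)
  then have "N (a j + (\<Sum>i\<in>I. a i)) \<le> N (a j) + N (\<Sum>i\<in>I. a i)"
    by (intro seminorm_add[OF assms(1)] sum_free_space) auto
  with insert show ?case by fastforce
qed

lemma seminorm_onI:
  assumes nonneg: "\<And>a. a \<in> free_space X \<Longrightarrow> 0 \<le> N a"
    and scale: "\<And>c a. a \<in> free_space X \<Longrightarrow> N (scale c a) \<le> cmod c * N a"
    and add: "\<And>a b. a \<in> free_space X \<Longrightarrow> b \<in> free_space X \<Longrightarrow> N (a + b) \<le> N a + N b"
  shows "seminorm_on X N"
proof -
  have "cmod c * N a \<le> N (scale c a)" if a: "a \<in> free_space X" for c a
  proof (cases "c = 0")
    case True
    then show ?thesis using nonneg[OF scale_free_space[OF a]] by simp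
  next
    case False
    have "scale (inverse c) (scale c a) = a"
      by (rule poly_mapping_eqI) (use False in simp)
    then have "N a \<le> inverse (cmod c) * N (scale c a)"
      using scale[OF scale_free_space[OF a], of "inverse c" c] by (simp add: norm_inverse)
    with False show ?thesis by (simp add: field_simps)
  qed
  then show ?thesis
    unfolding seminorm_on_def using assms by (blast intro: order_antisym)
qed

lemma unconditional_mono:
  assumes "unconditional_on X N" "a \<in> free_space X" "b \<in> free_space X"
    and "\<And>x. cmod (Poly_Mapping.lookup a x) \<le> cmod (Poly_Mapping.lookup b x)"
  shows "N a \<le> N b"
  using assms by (simp add: unconditional_on_def radial_le_modulus_iff)

lemma unconditional_modulus:
  assumes "unconditional_on X N" "a \<in> free_space X"
  shows "N (modulus a) = N a"
  by (rule order_antisym)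
    (simp_all add: unconditional_mono[OF assms(1)] assms(2) modulus_free_space)

text \<open>An unconditional seminorm is a supremum of weighted \<open>\<ell>\<^sup>1\<close>-seminorms, attained at each vector
  \<open>v\<close>. On the support of \<open>v\<close> the Hahn-Banach theorem gives a functional that is dominated by the
  seminorm and attains it at \<open>|v|\<close>. Its negative coefficients may be cut off: evaluating on
  vectors that vanish where the coefficients are negative does not increase the seminorm.\<close>

lemma norming_weights:
  fixes X :: "'x set"
  assumes N: "unconditional_seminorm_on X N" and v: "v \<in> free_space X"
  obtains g where "\<And>x. 0 \<le> g x"
    and "\<And>a. a \<in> free_space X \<Longrightarrow>
      (\<Sum>x\<in>Poly_Mapping.keys v. g x * cmod (Poly_Mapping.lookup a x)) \<le> N a"
    and "(\<Sum>x\<in>Poly_Mapping.keys v. g x * cmod (Poly_Mapping.lookup v x)) = N v"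
proof -
  have sn: "seminorm_on X N" and unc: "unconditional_on X N"
    using N by (auto simp: unconditional_seminorm_on_def)
  define S where "S = Poly_Mapping.keys v"
  have S: "finite S" "S \<subseteq> X"
    using v by (auto simp: S_def free_space_def)
  define vec where "vec u = (\<Sum>x\<in>S. Poly_Mapping.single x (complex_of_real (u x)))"
    for u :: "'x \<Rightarrow> real"
  have lookup_vec: "Poly_Mapping.lookup (vec u) x = (if x \<in> S then complex_of_real (u x) else 0)"
    for u x
  proof -
    have "Poly_Mapping.lookup (vec u) x = (\<Sum>z\<in>S. if x = z then complex_of_real (u z) else 0)"
      unfolding vec_def lookup_sum by (rule sum.cong) (auto simp: lookup_single when_def)
    then show ?thesis using S by simp
  qed
  have vec_free: "vec u \<in> free_space X" for u
    using S by (auto simp: free_space_iff lookup_vec)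
  have sub: "sublinear (\<lambda>u. N (vec u))"
  proof (rule sublinearI)
    fix u w
    have "vec (\<lambda>x. u x + w x) = vec u + vec w"
      by (rule poly_mapping_eqI) (simp add: lookup_vec lookup_add)
    then show "N (vec (\<lambda>x. u x + w x)) \<le> N (vec u) + N (vec w)"
      using seminorm_add[OF sn vec_free vec_free] by simp
  next
    fix t :: real and u
    assume "0 \<le> t"
    moreover have "vec (\<lambda>x. t * u x) = scale (complex_of_real t) (vec u)"
      by (rule poly_mapping_eqI) (simp add: lookup_vec)
    ultimately show "N (vec (\<lambda>x. t * u x)) \<le> t * N (vec u)"
      using seminorm_scale[OF sn vec_free] by simp
  qed
  define m where "m x = cmod (Poly_Mapping.lookup v x)" for x
  have m: "m x = 0" if "x \<notin> S" for x
    using that by (simp add: m_def S_def in_keys_iff)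
  obtain f where f: "\<And>u. (\<And>x. x \<notin> S \<Longrightarrow> u x = 0) \<Longrightarrow> (\<Sum>x\<in>S. f x * u x) \<le> N (vec u)"
    and fv: "(\<Sum>x\<in>S. f x * m x) = N (vec m)"
    using finite_hahn_banach[OF sub S(1), of m] m by blast
  define g where "g x = max (f x) 0" for x
  have dom: "(\<Sum>x\<in>S. g x * cmod (Poly_Mapping.lookup a x)) \<le> N a" if a: "a \<in> free_space X" for a
  proof -
    define u where
      "u x = (if x \<in> S \<and> 0 \<le> f x then cmod (Poly_Mapping.lookup a x) else 0)" for x
    have "(\<Sum>x\<in>S. g x * cmod (Poly_Mapping.lookup a x)) = (\<Sum>x\<in>S. f x * u x)"
      by (rule sum.cong) (auto simp: u_def g_def max_def)
    also have "\<dots> \<le> N (vec u)" by (rule f) (simp add: u_def)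
    also have "\<dots> \<le> N a"
      by (rule unconditional_mono[OF unc vec_free a]) (simp add: lookup_vec u_def)
    finally show ?thesis .
  qed
  have "N v \<le> N (vec m)"
    by (rule unconditional_mono[OF unc v vec_free])
      (simp add: lookup_vec m_def S_def in_keys_iff)
  also have "\<dots> \<le> (\<Sum>x\<in>S. g x * m x)"
    unfolding fv[symmetric] by (intro sum_mono mult_right_mono) (auto simp: g_def m_def)
  finally have "(\<Sum>x\<in>S. g x * cmod (Poly_Mapping.lookup v x)) = N v"
    using dom[OF v] by (simp add: m_def)
  with dom show ?thesis
    using that[of g] by (simp add: g_def S_def)
qed

section \<open>The seminorm given by radial majorants\<close>

definition majorant_costs ::
    "'x set \<Rightarrow> (('x \<Rightarrow>\<^sub>0 complex) \<Rightarrow> real) \<Rightarrow> 'y set \<Rightarrow> (('y \<Rightarrow>\<^sub>0 complex) \<Rightarrow> real) \<Rightarrow>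
     ('x \<times> 'y \<Rightarrow>\<^sub>0 complex) \<Rightarrow> real set" where
  "majorant_costs X NX Y NY \<alpha> =
     {\<Sum>i\<in>I. NX (\<alpha>' i) * NY (\<alpha>'' i) | (I :: nat set) \<alpha>' \<alpha>''.
        finite I \<and>
        (\<forall>i\<in>I. \<alpha>' i \<in> free_space X \<and> \<alpha>'' i \<in> free_space Y) \<and>
        radial_le (modulus \<alpha>) (\<Sum>i\<in>I. tensor (modulus (\<alpha>' i)) (modulus (\<alpha>'' i)))}"

definition majorant_seminorm ::
    "'x set \<Rightarrow> (('x \<Rightarrow>\<^sub>0 complex) \<Rightarrow> real) \<Rightarrow> 'y set \<Rightarrow> (('y \<Rightarrow>\<^sub>0 complex) \<Rightarrow> real) \<Rightarrow>
     ('x \<times> 'y \<Rightarrow>\<^sub>0 complex) \<Rightarrow> real" where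
  "majorant_seminorm X NX Y NY \<alpha> = Inf (majorant_costs X NX Y NY \<alpha>)"

text \<open>Families indexed by any finite set may be used, not only those indexed by natural numbers;
  disjoint sums of index sets and supports then serve as index sets without encoding.\<close>

lemma majorant_costsI:
  fixes I :: "'i set"
  assumes I: "finite I"
    and free: "\<And>i. i \<in> I \<Longrightarrow> a i \<in> free_space X" "\<And>i. i \<in> I \<Longrightarrow> b i \<in> free_space Y"
    and le: "\<And>x y. cmod (Poly_Mapping.lookup \<alpha> (x, y)) \<le>
        (\<Sum>i\<in>I. cmod (Poly_Mapping.lookup (a i) x) * cmod (Poly_Mapping.lookup (b i) y))"
  shows "(\<Sum>i\<in>I. NX (a i) * NY (b i)) \<in> majorant_costs X NX Y NY \<alpha>"
proof -
  obtain h where h: "bij_betw h {0..<card I} I"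
    using ex_bij_betw_nat_finite[OF I] by blast
  have reindex: "(\<Sum>n\<in>{0..<card I}. F (h n)) = (\<Sum>i\<in>I. F i)" for F :: "'i \<Rightarrow> real"
    by (rule sum.reindex_bij_betw[OF h])
  have "radial_le (modulus \<alpha>)
      (\<Sum>n\<in>{0..<card I}. tensor (modulus (a (h n))) (modulus (b (h n))))"
    unfolding radial_le_sum_tensor_iff
    using le reindex[of "\<lambda>i. cmod (Poly_Mapping.lookup (a i) _) * cmod (Poly_Mapping.lookup (b i) _)"]
    by simp
  moreover have "\<forall>n\<in>{0..<card I}. a (h n) \<in> free_space X \<and> b (h n) \<in> free_space Y"
    using free bij_betw_apply[OF h] by blast
  ultimately show ?thesis
    unfolding majorant_costs_def reindex[of "\<lambda>i. NX (a i) * NY (b i)", symmetric]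
    by (intro CollectI exI[of _ "{0..<card I}"] exI[of _ "\<lambda>n. a (h n)"] exI[of _ "\<lambda>n. b (h n)"]) simp
qed

lemma majorant_costsE:
  assumes "s \<in> majorant_costs X NX Y NY \<alpha>"
  obtains I :: "nat set" and a b where "finite I"
    and "\<And>i. i \<in> I \<Longrightarrow> a i \<in> free_space X" and "\<And>i. i \<in> I \<Longrightarrow> b i \<in> free_space Y"
    and "\<And>x y. cmod (Poly_Mapping.lookup \<alpha> (x, y)) \<le>
        (\<Sum>i\<in>I. cmod (Poly_Mapping.lookup (a i) x) * cmod (Poly_Mapping.lookup (b i) y))"
    and "s = (\<Sum>i\<in>I. NX (a i) * NY (b i))"
  using assms unfolding majorant_costs_def radial_le_sum_tensor_iff by blast

lemma majorant_costs_nonempty: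
  assumes "\<alpha> \<in> free_space (X \<times> Y)"
  shows "majorant_costs X NX Y NY \<alpha> \<noteq> {}"
proof -
  define a where "a p = Poly_Mapping.single (fst p) (Poly_Mapping.lookup \<alpha> p)" for p
  define b where "b p = Poly_Mapping.single (snd p) (1 :: complex)" for p :: "'a \<times> 'b"
  have "cmod (Poly_Mapping.lookup \<alpha> (x, y)) \<le>
      (\<Sum>p\<in>Poly_Mapping.keys \<alpha>. cmod (Poly_Mapping.lookup (a p) x) * cmod (Poly_Mapping.lookup (b p) y))"
    for x y
  proof (cases "(x, y) \<in> Poly_Mapping.keys \<alpha>")
    case True
    have "cmod (Poly_Mapping.lookup \<alpha> (x, y)) =
        cmod (Poly_Mapping.lookup (a (x, y)) x) * cmod (Poly_Mapping.lookup (b (x, y)) y)"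
      by (simp add: a_def b_def)
    also have "\<dots> \<le> (\<Sum>p\<in>Poly_Mapping.keys \<alpha>.
        cmod (Poly_Mapping.lookup (a p) x) * cmod (Poly_Mapping.lookup (b p) y))"
      using True by (intro member_le_sum) auto
    finally show ?thesis .
  next
    case False
    then show ?thesis by (simp add: in_keys_iff sum_nonneg)
  qed
  moreover have "a p \<in> free_space X" "b p \<in> free_space Y" if "p \<in> Poly_Mapping.keys \<alpha>" for p
    using that assms by (auto simp: a_def b_def free_space_def[of "X \<times> Y"] intro!: single_free_space)
  ultimately show ?thesis
    using majorant_costsI[of "Poly_Mapping.keys \<alpha>" a X b Y \<alpha> NX NY] by fastforce
qed

context
  fixes X :: "'x set" and Y :: "'y set"
    and NX :: "('x \<Rightarrow>\<^sub>0 complex) \<Rightarrow> real" and NY :: "('y \<Rightarrow>\<^sub>0 complex) \<Rightarrow> real"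
  assumes NX: "unconditional_seminorm_on X NX" and NY: "unconditional_seminorm_on Y NY"
begin

lemma seminorm_factors:
  shows "seminorm_on X NX" "seminorm_on Y NY" "unconditional_on X NX" "unconditional_on Y NY"
  using NX NY by (auto simp: unconditional_seminorm_on_def)

lemma majorant_costs_nonneg: "s \<in> majorant_costs X NX Y NY \<alpha> \<Longrightarrow> 0 \<le> s"
  by (elim majorant_costsE)
    (simp add: sum_nonneg seminorm_nonneg[OF seminorm_factors(1)]
      seminorm_nonneg[OF seminorm_factors(2)])

lemma majorant_seminorm_le: "s \<in> majorant_costs X NX Y NY \<alpha> \<Longrightarrow> majorant_seminorm X NX Y NY \<alpha> \<le> s"
  unfolding majorant_seminorm_def
  by (intro cInf_lower bdd_belowI[of _ 0] majorant_costs_nonneg)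

lemma majorant_seminorm_greatest:
  "\<alpha> \<in> free_space (X \<times> Y) \<Longrightarrow> (\<And>s. s \<in> majorant_costs X NX Y NY \<alpha> \<Longrightarrow> c \<le> s) \<Longrightarrow>
     c \<le> majorant_seminorm X NX Y NY \<alpha>"
  unfolding majorant_seminorm_def by (intro cInf_greatest majorant_costs_nonempty)

lemma majorant_costs_add:
  assumes "s \<in> majorant_costs X NX Y NY \<alpha>" and "t \<in> majorant_costs X NX Y NY \<beta>"
  shows "s + t \<in> majorant_costs X NX Y NY (\<alpha> + \<beta>)"
proof -
  from assms(1) obtain I :: "nat set" and a b where 1: "finite I"
    "\<And>i. i \<in> I \<Longrightarrow> a i \<in> free_space X" "\<And>i. i \<in> I \<Longrightarrow> b i \<in> free_space Y"
    "\<And>x y. cmod (Poly_Mapping.lookup \<alpha> (x, y)) \<le>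
        (\<Sum>i\<in>I. cmod (Poly_Mapping.lookup (a i) x) * cmod (Poly_Mapping.lookup (b i) y))"
    "s = (\<Sum>i\<in>I. NX (a i) * NY (b i))"
    by (rule majorant_costsE) blast
  from assms(2) obtain J :: "nat set" and c d where 2: "finite J"
    "\<And>i. i \<in> J \<Longrightarrow> c i \<in> free_space X" "\<And>i. i \<in> J \<Longrightarrow> d i \<in> free_space Y"
    "\<And>x y. cmod (Poly_Mapping.lookup \<beta> (x, y)) \<le>
        (\<Sum>i\<in>J. cmod (Poly_Mapping.lookup (c i) x) * cmod (Poly_Mapping.lookup (d i) y))"
    "t = (\<Sum>i\<in>J. NX (c i) * NY (d i))"
    by (rule majorant_costsE) blast
  have "(\<Sum>k\<in>I <+> J. NX (case_sum a c k) * NY (case_sum b d k)) \<in>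
      majorant_costs X NX Y NY (\<alpha> + \<beta>)"
  proof (rule majorant_costsI)
    fix x y
    have "cmod (Poly_Mapping.lookup (\<alpha> + \<beta>) (x, y)) \<le>
        cmod (Poly_Mapping.lookup \<alpha> (x, y)) + cmod (Poly_Mapping.lookup \<beta> (x, y))"
      by (simp add: lookup_add norm_triangle_ineq)
    then show "cmod (Poly_Mapping.lookup (\<alpha> + \<beta>) (x, y)) \<le> (\<Sum>k\<in>I <+> J.
        cmod (Poly_Mapping.lookup (case_sum a c k) x) * cmod (Poly_Mapping.lookup (case_sum b d k) y))"
      using 1(1) 1(4)[of x y] 2(1) 2(4)[of x y] by (simp add: sum.Plus)
  qed (use 1 2 in auto)
  then show ?thesis using 1(1,5) 2(1,5) by (simp add: sum.Plus)
qed

lemma majorant_costs_scale: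
  assumes "s \<in> majorant_costs X NX Y NY \<alpha>"
  shows "cmod c * s \<in> majorant_costs X NX Y NY (scale c \<alpha>)"
proof -
  from assms obtain I :: "nat set" and a b where *: "finite I"
    "\<And>i. i \<in> I \<Longrightarrow> a i \<in> free_space X" "\<And>i. i \<in> I \<Longrightarrow> b i \<in> free_space Y"
    "\<And>x y. cmod (Poly_Mapping.lookup \<alpha> (x, y)) \<le>
        (\<Sum>i\<in>I. cmod (Poly_Mapping.lookup (a i) x) * cmod (Poly_Mapping.lookup (b i) y))"
    "s = (\<Sum>i\<in>I. NX (a i) * NY (b i))"
    by (rule majorant_costsE) blast
  have "(\<Sum>i\<in>I. NX (scale c (a i)) * NY (b i)) \<in> majorant_costs X NX Y NY (scale c \<alpha>)"
  proof (rule majorant_costsI)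
    fix x y
    show "cmod (Poly_Mapping.lookup (scale c \<alpha>) (x, y)) \<le> (\<Sum>i\<in>I.
        cmod (Poly_Mapping.lookup (scale c (a i)) x) * cmod (Poly_Mapping.lookup (b i) y))"
      using mult_left_mono[OF *(4)[of x y], of "cmod c"]
      by (simp add: norm_mult sum_distrib_left mult.assoc)
  qed (use * in \<open>auto intro: scale_free_space\<close>)
  moreover have "(\<Sum>i\<in>I. NX (scale c (a i)) * NY (b i)) = cmod c * s"
    unfolding *(5) sum_distrib_left
    by (rule sum.cong) (simp_all add: seminorm_scale[OF seminorm_factors(1)] *(2) mult.assoc)
  ultimately show ?thesis by simp
qed

lemma seminorm_majorant: "seminorm_on (X \<times> Y) (majorant_seminorm X NX Y NY)"
proof (rule seminorm_onI)
  fix \<alpha> :: "'x \<times> 'y \<Rightarrow>\<^sub>0 complex" assume \<alpha>: "\<alpha> \<in> free_space (X \<times> Y)"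
  show "0 \<le> majorant_seminorm X NX Y NY \<alpha>"
    by (rule majorant_seminorm_greatest[OF \<alpha>]) (rule majorant_costs_nonneg)
  fix c
  have scaled: "majorant_seminorm X NX Y NY (scale c \<alpha>) \<le> cmod c * s"
    if "s \<in> majorant_costs X NX Y NY \<alpha>" for s
    by (rule majorant_seminorm_le[OF majorant_costs_scale[OF that]])
  show "majorant_seminorm X NX Y NY (scale c \<alpha>) \<le> cmod c * majorant_seminorm X NX Y NY \<alpha>"
  proof (cases "c = 0")
    case True
    then show ?thesis using scaled majorant_costs_nonempty[OF \<alpha>] by fastforce
  next
    case False
    have "majorant_seminorm X NX Y NY (scale c \<alpha>) / cmod c \<le> majorant_seminorm X NX Y NY \<alpha>"
      using scaled False by (intro majorant_seminorm_greatest[OF \<alpha>]) (simp add: field_simps)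
    with False show ?thesis by (simp add: field_simps)
  qed
next
  fix \<alpha> \<beta> :: "'x \<times> 'y \<Rightarrow>\<^sub>0 complex"
  assume \<alpha>: "\<alpha> \<in> free_space (X \<times> Y)" and \<beta>: "\<beta> \<in> free_space (X \<times> Y)"
  have "majorant_seminorm X NX Y NY (\<alpha> + \<beta>) - t \<le> majorant_seminorm X NX Y NY \<alpha>"
    if "t \<in> majorant_costs X NX Y NY \<beta>" for t
    using majorant_seminorm_le[OF majorant_costs_add[OF _ that]]
    by (intro majorant_seminorm_greatest[OF \<alpha>]) (simp add: algebra_simps)
  then have "majorant_seminorm X NX Y NY (\<alpha> + \<beta>) - majorant_seminorm X NX Y NY \<alpha>
      \<le> majorant_seminorm X NX Y NY \<beta>"
    by (intro majorant_seminorm_greatest[OF \<beta>]) (simp add: algebra_simps)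
  then show "majorant_seminorm X NX Y NY (\<alpha> + \<beta>)
      \<le> majorant_seminorm X NX Y NY \<alpha> + majorant_seminorm X NX Y NY \<beta>"
    by simp
qed

lemma unconditional_majorant: "unconditional_on (X \<times> Y) (majorant_seminorm X NX Y NY)"
  unfolding unconditional_on_def radial_le_modulus_iff
proof (intro ballI impI)
  fix \<alpha> \<beta> :: "'x \<times> 'y \<Rightarrow>\<^sub>0 complex"
  assume \<beta>: "\<beta> \<in> free_space (X \<times> Y)"
    and le: "\<forall>p. cmod (Poly_Mapping.lookup \<alpha> p) \<le> cmod (Poly_Mapping.lookup \<beta> p)"
  have "majorant_costs X NX Y NY \<beta> \<subseteq> majorant_costs X NX Y NY \<alpha>"
  proof
    fix s assume "s \<in> majorant_costs X NX Y NY \<beta>"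
    then obtain I :: "nat set" and a b where *: "finite I"
      "\<And>i. i \<in> I \<Longrightarrow> a i \<in> free_space X" "\<And>i. i \<in> I \<Longrightarrow> b i \<in> free_space Y"
      "\<And>x y. cmod (Poly_Mapping.lookup \<beta> (x, y)) \<le>
          (\<Sum>i\<in>I. cmod (Poly_Mapping.lookup (a i) x) * cmod (Poly_Mapping.lookup (b i) y))"
      "s = (\<Sum>i\<in>I. NX (a i) * NY (b i))"
      by (rule majorant_costsE) blast
    show "s \<in> majorant_costs X NX Y NY \<alpha>"
      unfolding *(5) by (rule majorant_costsI) (use * le order_trans in blast)+
  qed
  then show "majorant_seminorm X NX Y NY \<alpha> \<le> majorant_seminorm X NX Y NY \<beta>"
    by (intro majorant_seminorm_greatest[OF \<beta>] majorant_seminorm_le) blast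
qed

text \<open>Integrating a majorization of \<open>|v| \<otimes> |w|\<close> against the product of norming weights for
  \<open>v\<close> and \<open>w\<close> bounds the cost of the majorant from below, since the integral of
  \<open>|a| \<otimes> |b|\<close> factorizes.\<close>

lemma elementary_tensor_cost_ge:
  assumes v: "v \<in> free_space X" and w: "w \<in> free_space Y"
    and "s \<in> majorant_costs X NX Y NY (tensor v w)"
  shows "NX v * NY w \<le> s"
proof -
  from assms(3) obtain I :: "nat set" and a b where *: "finite I"
    "\<And>i. i \<in> I \<Longrightarrow> a i \<in> free_space X" "\<And>i. i \<in> I \<Longrightarrow> b i \<in> free_space Y"
    "\<And>x y. cmod (Poly_Mapping.lookup (tensor v w) (x, y)) \<le>
        (\<Sum>i\<in>I. cmod (Poly_Mapping.lookup (a i) x) * cmod (Poly_Mapping.lookup (b i) y))"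
    "s = (\<Sum>i\<in>I. NX (a i) * NY (b i))"
    by (rule majorant_costsE) blast
  obtain g where g: "\<And>x. 0 \<le> g x"
    "\<And>a. a \<in> free_space X \<Longrightarrow>
      (\<Sum>x\<in>Poly_Mapping.keys v. g x * cmod (Poly_Mapping.lookup a x)) \<le> NX a"
    "(\<Sum>x\<in>Poly_Mapping.keys v. g x * cmod (Poly_Mapping.lookup v x)) = NX v"
    using norming_weights[OF NX v] by blast
  obtain h where h: "\<And>y. 0 \<le> h y"
    "\<And>b. b \<in> free_space Y \<Longrightarrow>
      (\<Sum>y\<in>Poly_Mapping.keys w. h y * cmod (Poly_Mapping.lookup b y)) \<le> NY b"
    "(\<Sum>y\<in>Poly_Mapping.keys w. h y * cmod (Poly_Mapping.lookup w y)) = NY w"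
    using norming_weights[OF NY w] by blast
  let ?K = "Poly_Mapping.keys v" and ?L = "Poly_Mapping.keys w"
  let ?G = "\<lambda>a. \<Sum>x\<in>?K. g x * cmod (Poly_Mapping.lookup a x)"
  let ?H = "\<lambda>b. \<Sum>y\<in>?L. h y * cmod (Poly_Mapping.lookup b y)"
  have product: "?G a * ?H b = (\<Sum>x\<in>?K. \<Sum>y\<in>?L. g x * h y *
      (cmod (Poly_Mapping.lookup a x) * cmod (Poly_Mapping.lookup b y)))" for a b
    by (simp add: sum_product algebra_simps)
  have "NX v * NY w = ?G v * ?H w" by (simp add: g(3) h(3))
  also have "\<dots> \<le> (\<Sum>x\<in>?K. \<Sum>y\<in>?L. g x * h y *
      (\<Sum>i\<in>I. cmod (Poly_Mapping.lookup (a i) x) * cmod (Poly_Mapping.lookup (b i) y)))"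
    unfolding product
    by (intro sum_mono mult_left_mono) (use *(4) g(1) h(1) in \<open>simp_all add: norm_mult\<close>)
  also have "\<dots> = (\<Sum>x\<in>?K. \<Sum>i\<in>I. \<Sum>y\<in>?L. g x * h y *
      (cmod (Poly_Mapping.lookup (a i) x) * cmod (Poly_Mapping.lookup (b i) y)))"
    unfolding sum_distrib_left by (intro sum.cong refl sum.swap)
  also have "\<dots> = (\<Sum>i\<in>I. ?G (a i) * ?H (b i))"
    unfolding product by (rule sum.swap)
  also have "\<dots> \<le> s"
    unfolding *(5)
    by (intro sum_mono mult_mono g(2) h(2) *(2,3) seminorm_nonneg[OF seminorm_factors(1)]
        sum_nonneg mult_nonneg_nonneg h(1) norm_ge_zero)
  finally show ?thesis .
qed

lemma cross_majorant: "cross_seminorm_on X NX Y NY (majorant_seminorm X NX Y NY)"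
  unfolding cross_seminorm_on_def
proof (intro conjI ballI seminorm_majorant order_antisym)
  fix v w
  assume v: "v \<in> free_space X" and w: "w \<in> free_space Y"
  have "(\<Sum>i\<in>{()}. NX v * NY w) \<in> majorant_costs X NX Y NY (tensor v w)"
    by (rule majorant_costsI) (use v w in \<open>auto simp: norm_mult\<close>)
  then show "majorant_seminorm X NX Y NY (tensor v w) \<le> NX v * NY w"
    by (intro majorant_seminorm_le) simp
  show "NX v * NY w \<le> majorant_seminorm X NX Y NY (tensor v w)"
    by (intro majorant_seminorm_greatest tensor_free_space elementary_tensor_cost_ge v w)
qed

section \<open>Comparison with the projective cross-seminorm\<close>

lemma cross_seminorm_sum_tensor_le:
  assumes M: "cross_seminorm_on X NX Y NY M" and I: "finite I"
    and free: "\<And>i. i \<in> I \<Longrightarrow> a i \<in> free_space X" "\<And>i. i \<in> I \<Longrightarrow> b i \<in> free_space Y"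
  shows "M (\<Sum>i\<in>I. tensor (modulus (a i)) (modulus (b i))) \<le> (\<Sum>i\<in>I. NX (a i) * NY (b i))"
proof -
  have "M (\<Sum>i\<in>I. tensor (modulus (a i)) (modulus (b i)))
      \<le> (\<Sum>i\<in>I. M (tensor (modulus (a i)) (modulus (b i))))"
    using M free
    by (intro seminorm_sum[OF _ I])
      (auto simp: cross_seminorm_on_def intro!: tensor_free_space modulus_free_space)
  also have "\<dots> = (\<Sum>i\<in>I. NX (a i) * NY (b i))"
    using M free
    by (intro sum.cong refl)
      (simp add: cross_seminorm_on_def modulus_free_space unconditional_modulus[OF seminorm_factors(3)]
        unconditional_modulus[OF seminorm_factors(4)])
  finally show ?thesis .
qed

text \<open>Cross-seminorms are bounded on each vector by the costs of its expansion into
  basis tensors, so that their pointwise supremum is finite. It is again a cross-seminorm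
  provided that at least one cross-seminorm exists, which \<open>cross_majorant\<close> guarantees.\<close>

lemma cross_seminorm_bounded:
  assumes \<alpha>: "\<alpha> \<in> free_space (X \<times> Y)"
  obtains B where "\<And>M. cross_seminorm_on X NX Y NY M \<Longrightarrow> M \<alpha> \<le> B"
proof
  fix M
  assume M: "cross_seminorm_on X NX Y NY M"
  define a where "a p = Poly_Mapping.single (fst p) (Poly_Mapping.lookup \<alpha> p)" for p
  define b where "b p = Poly_Mapping.single (snd p) (1 :: complex)" for p :: "'x \<times> 'y"
  have ab: "a p \<in> free_space X" "b p \<in> free_space Y" if "p \<in> Poly_Mapping.keys \<alpha>" for p
    using that \<alpha> by (auto simp: a_def b_def free_space_def[of "X \<times> Y"] intro!: single_free_space)
  have expand: "\<alpha> = (\<Sum>p\<in>Poly_Mapping.keys \<alpha>. tensor (a p) (b p))"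
  proof (rule poly_mapping_eqI)
    fix q
    have "Poly_Mapping.lookup (\<Sum>p\<in>Poly_Mapping.keys \<alpha>. tensor (a p) (b p)) q =
        (\<Sum>p\<in>Poly_Mapping.keys \<alpha>. if q = p then Poly_Mapping.lookup \<alpha> p else 0)"
      unfolding lookup_sum
      by (rule sum.cong) (auto simp: a_def b_def tensor_single_single lookup_single when_def)
    then show "Poly_Mapping.lookup \<alpha> q =
        Poly_Mapping.lookup (\<Sum>p\<in>Poly_Mapping.keys \<alpha>. tensor (a p) (b p)) q"
      by (simp add: in_keys_iff)
  qed
  have "M \<alpha> = M (\<Sum>p\<in>Poly_Mapping.keys \<alpha>. tensor (a p) (b p))"
    by (rule arg_cong[OF expand, of M])
  also have "\<dots> \<le> (\<Sum>p\<in>Poly_Mapping.keys \<alpha>. M (tensor (a p) (b p)))"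
    using M by (intro seminorm_sum[of "X \<times> Y"] tensor_free_space ab)
      (simp_all add: cross_seminorm_on_def)
  also have "\<dots> = (\<Sum>p\<in>Poly_Mapping.keys \<alpha>. NX (a p) * NY (b p))"
    using M ab by (intro sum.cong refl) (simp add: cross_seminorm_on_def)
  finally show "M \<alpha> \<le> (\<Sum>p\<in>Poly_Mapping.keys \<alpha>.
      NX (Poly_Mapping.single (fst p) (Poly_Mapping.lookup \<alpha> p)) * NY (Poly_Mapping.single (snd p) 1))"
    by (simp add: a_def b_def)
qed

lemma largest_cross_seminorm_exists:
  "\<exists>N. is_largest_on (X \<times> Y) (cross_seminorm_on X NX Y NY) N"
proof -
  define C where "C = {M. cross_seminorm_on X NX Y NY M}"
  define P where "P \<alpha> = (SUP M\<in>C. M \<alpha>)" for \<alpha>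
  have CI: "majorant_seminorm X NX Y NY \<in> C"
    using cross_majorant by (simp add: C_def)
  then have C: "C \<noteq> {}" by blast
  have sn: "seminorm_on (X \<times> Y) M" if "M \<in> C" for M
    using that by (simp add: C_def cross_seminorm_on_def)
  have upper: "M \<alpha> \<le> P \<alpha>" if "M \<in> C" and \<alpha>: "\<alpha> \<in> free_space (X \<times> Y)" for M \<alpha>
  proof -
    obtain B where "\<And>M. cross_seminorm_on X NX Y NY M \<Longrightarrow> M \<alpha> \<le> B"
      by (rule cross_seminorm_bounded[OF \<alpha>]) blast
    then have "bdd_above ((\<lambda>M. M \<alpha>) ` C)"
      by (intro bdd_aboveI2[where M = B]) (simp add: C_def)
    then show ?thesis
      unfolding P_def by (rule cSUP_upper[OF that(1)])
  qed
  have least: "P \<alpha> \<le> c" if "\<And>M. M \<in> C \<Longrightarrow> M \<alpha> \<le> c" for \<alpha> c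
    unfolding P_def using that by (rule cSUP_least[OF C])
  have "seminorm_on (X \<times> Y) P"
  proof (rule seminorm_onI)
    fix \<alpha> :: "'x \<times> 'y \<Rightarrow>\<^sub>0 complex" assume \<alpha>: "\<alpha> \<in> free_space (X \<times> Y)"
    show "0 \<le> P \<alpha>"
      using upper[OF CI \<alpha>] seminorm_nonneg[OF sn[OF CI] \<alpha>] by simp
    show "P (scale c \<alpha>) \<le> cmod c * P \<alpha>" for c
      using upper[OF _ \<alpha>] by (intro least) (simp add: seminorm_scale[OF sn \<alpha>] mult_left_mono)
  next
    fix \<alpha> \<beta> :: "'x \<times> 'y \<Rightarrow>\<^sub>0 complex"
    assume \<alpha>: "\<alpha> \<in> free_space (X \<times> Y)" and \<beta>: "\<beta> \<in> free_space (X \<times> Y)"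
    show "P (\<alpha> + \<beta>) \<le> P \<alpha> + P \<beta>"
    proof (rule least)
      fix M assume M: "M \<in> C"
      have "M (\<alpha> + \<beta>) \<le> M \<alpha> + M \<beta>"
        by (rule seminorm_add[OF sn[OF M] \<alpha> \<beta>])
      also have "\<dots> \<le> P \<alpha> + P \<beta>"
        by (rule add_mono[OF upper[OF M \<alpha>] upper[OF M \<beta>]])
      finally show "M (\<alpha> + \<beta>) \<le> P \<alpha> + P \<beta>" .
    qed
  qed
  moreover have "P (tensor v w) = NX v * NY w" if "v \<in> free_space X" "w \<in> free_space Y" for v w
  proof -
    have "(\<lambda>M. M (tensor v w)) ` C = {NX v * NY w}"
      using C that by (auto simp: C_def cross_seminorm_on_def)
    then show ?thesis by (simp add: P_def)
  qed
  ultimately show ?thesis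
    using upper unfolding is_largest_on_def cross_seminorm_on_def C_def
    by (intro exI[of _ P]) (simp add: cross_seminorm_on_def)
qed

lemma projective_largest:
  "is_largest_on (X \<times> Y) (cross_seminorm_on X NX Y NY) (projective X NX Y NY)"
  unfolding projective_def by (rule someI_ex[OF largest_cross_seminorm_exists])

text \<open>The projective seminorm dominates the majorant seminorm because the latter is a
  cross-seminorm; in the other direction, each majorant \<open>\<Sum>|a\<^sub>i| \<otimes> |b\<^sub>i|\<close> is itself a radial
  competitor in the infimum that defines the associated unconditional seminorm.\<close>

lemma assoc_unconditional_projective:
  assumes \<alpha>: "\<alpha> \<in> free_space (X \<times> Y)"
  shows "assoc_unconditional (X \<times> Y) (projective X NX Y NY) \<alpha> = majorant_seminorm X NX Y NY \<alpha>"
proof -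
  let ?P = "projective X NX Y NY" and ?U = "majorant_seminorm X NX Y NY"
  let ?A = "{?P (modulus \<beta>) | \<beta>. \<beta> \<in> free_space (X \<times> Y) \<and> radial_le (modulus \<alpha>) (modulus \<beta>)}"
  have P: "cross_seminorm_on X NX Y NY ?P"
    and P_ge: "\<And>\<beta>. \<beta> \<in> free_space (X \<times> Y) \<Longrightarrow> ?U \<beta> \<le> ?P \<beta>"
    using projective_largest cross_majorant by (auto simp: is_largest_on_def)
  have lower: "?U \<alpha> \<le> s" if "s \<in> ?A" for s
  proof -
    from that obtain \<beta> where \<beta>: "\<beta> \<in> free_space (X \<times> Y)" "radial_le (modulus \<alpha>) (modulus \<beta>)"
      and s: "s = ?P (modulus \<beta>)" by blast
    have "?U \<alpha> \<le> ?U \<beta>"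
      using unconditional_majorant \<alpha> \<beta> by (simp add: unconditional_on_def)
    also have "\<dots> = ?U (modulus \<beta>)"
      by (rule unconditional_modulus[OF unconditional_majorant \<beta>(1), symmetric])
    also have "\<dots> \<le> s"
      unfolding s by (rule P_ge[OF modulus_free_space[OF \<beta>(1)]])
    finally show ?thesis .
  qed
  have "Inf ?A = ?U \<alpha>"
  proof (rule order_antisym)
    show "?U \<alpha> \<le> Inf ?A"
      using \<alpha> by (intro cInf_greatest lower) (auto simp: radial_le_modulus_iff)
    show "Inf ?A \<le> ?U \<alpha>"
    proof (rule majorant_seminorm_greatest[OF \<alpha>])
      fix s assume "s \<in> majorant_costs X NX Y NY \<alpha>"
      then obtain I :: "nat set" and a b where *: "finite I"
        "\<And>i. i \<in> I \<Longrightarrow> a i \<in> free_space X" "\<And>i. i \<in> I \<Longrightarrow> b i \<in> free_space Y"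
        "radial_le (modulus \<alpha>) (\<Sum>i\<in>I. tensor (modulus (a i)) (modulus (b i)))"
        and s: "s = (\<Sum>i\<in>I. NX (a i) * NY (b i))"
        unfolding majorant_costs_def by blast
      let ?\<beta> = "\<Sum>i\<in>I. tensor (modulus (a i)) (modulus (b i))"
      have "?\<beta> \<in> free_space (X \<times> Y)"
        by (intro sum_free_space tensor_free_space modulus_free_space *)
      then have "?P (modulus ?\<beta>) \<in> ?A"
        using *(4) modulus_sum_tensor_modulus[of a b I] by fastforce
      then have "Inf ?A \<le> ?P (modulus ?\<beta>)"
        by (intro cInf_lower bdd_belowI[of _ "?U \<alpha>"] lower)
      also have "\<dots> \<le> s"
        unfolding s modulus_sum_tensor_modulus
        by (rule cross_seminorm_sum_tensor_le[OF P *(1-3)])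
      finally show "Inf ?A \<le> s" .
    qed
  qed
  then show ?thesis by (simp add: assoc_unconditional_def)
qed

lemma unconditional_cross_seminorm_le_majorant:
  assumes M: "cross_seminorm_on X NX Y NY M" and unc: "unconditional_on (X \<times> Y) M"
    and \<alpha>: "\<alpha> \<in> free_space (X \<times> Y)"
  shows "M \<alpha> \<le> majorant_seminorm X NX Y NY \<alpha>"
proof (rule majorant_seminorm_greatest[OF \<alpha>])
  fix s assume "s \<in> majorant_costs X NX Y NY \<alpha>"
  then obtain I :: "nat set" and a b where *: "finite I"
    "\<And>i. i \<in> I \<Longrightarrow> a i \<in> free_space X" "\<And>i. i \<in> I \<Longrightarrow> b i \<in> free_space Y"
    "radial_le (modulus \<alpha>) (\<Sum>i\<in>I. tensor (modulus (a i)) (modulus (b i)))"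
    and s: "s = (\<Sum>i\<in>I. NX (a i) * NY (b i))"
    unfolding majorant_costs_def by blast
  have "M \<alpha> \<le> M (\<Sum>i\<in>I. tensor (modulus (a i)) (modulus (b i)))"
    using unc \<alpha> *(4) unfolding unconditional_on_def
    by (simp add: sum_free_space tensor_free_space modulus_free_space *(2,3)
        modulus_sum_tensor_modulus)
  also have "\<dots> \<le> s"
    unfolding s by (rule cross_seminorm_sum_tensor_le[OF M *(1-3)])
  finally show "M \<alpha> \<le> s" .
qed

end

theorem proposition2p7:
  fixes X :: "'x set" and Y :: "'y set"
    and NX :: "('x \<Rightarrow>\<^sub>0 complex) \<Rightarrow> real" and NY :: "('y \<Rightarrow>\<^sub>0 complex) \<Rightarrow> real"
  assumes "unconditional_seminorm_on X NX" and "unconditional_seminorm_on Y NY"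
  shows "(\<forall>\<alpha>\<in>free_space (X \<times> Y).
            assoc_unconditional (X \<times> Y) (projective X NX Y NY) \<alpha> =
            Inf {\<Sum>i\<in>I. NX (\<alpha>' i) * NY (\<alpha>'' i) | (I :: nat set) \<alpha>' \<alpha>''.
                   finite I \<and>
                   (\<forall>i\<in>I. \<alpha>' i \<in> free_space X \<and> \<alpha>'' i \<in> free_space Y) \<and>
                   radial_le (modulus \<alpha>) (\<Sum>i\<in>I. tensor (modulus (\<alpha>' i)) (modulus (\<alpha>'' i)))}) \<and>
         is_largest_on (X \<times> Y)
           (\<lambda>N. cross_seminorm_on X NX Y NY N \<and> unconditional_on (X \<times> Y) N)
           (assoc_unconditional (X \<times> Y) (projective X NX Y NY))"
proof (intro conjI ballI)
  let ?A = "assoc_unconditional (X \<times> Y) (projective X NX Y NY)"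
  note eq = assoc_unconditional_projective[OF assms]
  fix \<alpha> :: "'x \<times> 'y \<Rightarrow>\<^sub>0 complex"
  assume "\<alpha> \<in> free_space (X \<times> Y)"
  from eq[OF this, unfolded majorant_seminorm_def majorant_costs_def]
  show "?A \<alpha> = Inf {\<Sum>i\<in>I. NX (\<alpha>' i) * NY (\<alpha>'' i) | (I :: nat set) \<alpha>' \<alpha>''.
                   finite I \<and>
                   (\<forall>i\<in>I. \<alpha>' i \<in> free_space X \<and> \<alpha>'' i \<in> free_space Y) \<and>
                   radial_le (modulus \<alpha>) (\<Sum>i\<in>I. tensor (modulus (\<alpha>' i)) (modulus (\<alpha>'' i)))}" .
next
  let ?A = "assoc_unconditional (X \<times> Y) (projective X NX Y NY)"
  note eq = assoc_unconditional_projective[OF assms]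
  have "cross_seminorm_on X NX Y NY ?A"
    using cross_majorant[OF assms] unfolding cross_seminorm_on_def seminorm_on_def
    by (simp add: eq add_free_space scale_free_space tensor_free_space)
  moreover have "unconditional_on (X \<times> Y) ?A"
    using unconditional_majorant[OF assms] by (simp add: unconditional_on_def eq)
  ultimately show "is_largest_on (X \<times> Y)
      (\<lambda>N. cross_seminorm_on X NX Y NY N \<and> unconditional_on (X \<times> Y) N) ?A"
    unfolding is_largest_on_def
    using unconditional_cross_seminorm_le_majorant[OF assms] by (simp add: eq)
qed

end
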